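(* For every $n\ge0$, as linear maps on the space of polynomials of degree at most $n$, $$F_nU_n^{-1}=V_n^{-1}C_nV_n .$$
   Context: Polynomials over $\mathbb{C}$; $(y)_p=y(y-1)\cdots(y-p+1)$, $[y]_k=y(y+1)\cdots(y+k-1)$. On polynomials of degree at most $n$: $U_n^{-1}x^p=(x)_p[x+1]_{n-p}$ (inverse of $U_nx^p=\frac{(1-x)^{n+1}}{n!}\sum_{m\ge0}m^px^m$); $F_nx^p=(1-x)^{2n+1}\sum_{m\ge0}m^p\binom{m+n}{n}x^m$ (with inverse $F_n^{-1}x^p=\frac{n!}{(2n)!}(x)_p[x+n+1]_{n-p}$); $V_nc(x)=(1+x)^nc\big(\frac{x}{1+x}\big)$, $V_n^{-1}c(x)=(1-x)^nc\big(\frac{x}{1-x}\big)$; $C_nx^p=\frac{(n+p)!}{p!}x^p$. *)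

theory Defs
  imports
    Complex_Main
    "HOL-Computational_Algebra.Computational_Algebra"
begin

definition falling :: "'a::comm_ring_1 \<Rightarrow> nat \<Rightarrow> 'a" where
  "falling y p = (\<Prod>i<p. y - of_nat i)"

text \<open>
  The rising factorial \<open>[y]\<^sub>k\<close> is \<^const>\<open>pochhammer\<close>; applied to \<open>[:0, 1:]\<close> and
  \<open>[:1, 1:]\<close>, both factorials yield polynomials in \<open>x\<close>.

  The operators act on the polynomials of degree at most \<open>n\<close> and are given by their values on
  the monomials \<open>x^p\<close>, \<open>p \<le> n\<close>. Coefficients beyond \<open>n\<close> are ignored, so the operators are
  meaningful only for arguments of degree at most \<open>n\<close>.
\<close>

definition lin_ext :: "nat \<Rightarrow> (nat \<Rightarrow> complex poly) \<Rightarrow> complex poly \<Rightarrow> complex poly" where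
  "lin_ext n T c = (\<Sum>p\<le>n. smult (coeff c p) (T p))"

text \<open>
  The series defining \<open>U\<^sub>n\<close> and \<open>F\<^sub>n\<close> are formal power series which happen to be polynomials;
  existence is shown below (\<open>opU_series\<close>, \<open>opF_series\<close>), uniqueness is \<open>fps_of_poly_eq_iff\<close>.
\<close>

definition poly_of_fps :: "complex fps \<Rightarrow> complex poly" where
  "poly_of_fps f = (THE q. fps_of_poly q = f)"

definition opU :: "nat \<Rightarrow> complex poly \<Rightarrow> complex poly" where
  "opU n = lin_ext n (\<lambda>p. poly_of_fps
     (fps_const (1 / fact n) * (1 - fps_X) ^ (n + 1) * Abs_fps (\<lambda>m. of_nat m ^ p)))"

definition opU_inv :: "nat \<Rightarrow> complex poly \<Rightarrow> complex poly" where
  "opU_inv n = lin_ext n (\<lambda>p. falling [:0, 1:] p * pochhammer [:1, 1:] (n - p))"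

definition opF :: "nat \<Rightarrow> complex poly \<Rightarrow> complex poly" where
  "opF n = lin_ext n (\<lambda>p. poly_of_fps
     ((1 - fps_X) ^ (2 * n + 1) * Abs_fps (\<lambda>m. of_nat m ^ p * of_nat ((m + n) choose n))))"

definition opC :: "nat \<Rightarrow> complex poly \<Rightarrow> complex poly" where
  "opC n = lin_ext n (\<lambda>p. monom (fact (n + p) / fact p) p)"

text \<open>
  \<open>(1 + x)^n (x / (1 + x))^p = x^p (1 + x)^(n - p)\<close>, and similarly with \<open>1 - x\<close>;
  see \<open>poly_opV\<close> and \<open>poly_opV_inv\<close> for the closed forms.
\<close>

definition opV :: "nat \<Rightarrow> complex poly \<Rightarrow> complex poly" where
  "opV n = lin_ext n (\<lambda>p. monom 1 p * [:1, 1:] ^ (n - p))"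

definition opV_inv :: "nat \<Rightarrow> complex poly \<Rightarrow> complex poly" where
  "opV_inv n = lin_ext n (\<lambda>p. monom 1 p * [:1, - 1:] ^ (n - p))"


lemma lin_ext_add: "lin_ext n T (c + d) = lin_ext n T c + lin_ext n T d"
  by (simp add: lin_ext_def smult_add_left sum.distrib)

lemma lin_ext_smult: "lin_ext n T (smult a c) = smult a (lin_ext n T c)"
  by (rule poly_eqI) (simp add: lin_ext_def coeff_sum sum_distrib_left mult.assoc)

lemma lin_ext_monom: "p \<le> n \<Longrightarrow> lin_ext n T (monom a p) = smult a (T p)"
  by (simp add: lin_ext_def coeff_monom if_distrib [of "\<lambda>a. smult a _"] cong: if_cong)

lemma lin_ext_id: "degree c \<le> n \<Longrightarrow> lin_ext n (monom 1) c = c"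
  by (rule poly_eqI)
     (auto simp: lin_ext_def coeff_sum coeff_monom if_distrib coeff_eq_0 cong: if_cong)

lemma degree_lin_ext:
  assumes "\<And>p. p \<le> n \<Longrightarrow> degree (T p) \<le> n"
  shows "degree (lin_ext n T c) \<le> n"
  unfolding lin_ext_def
  by (rule degree_sum_le) (use assms in auto)

lemma lin_ext_comp:
  assumes "\<And>a b. G (a + b) = G a + G b" "\<And>a b. G (smult a b) = smult a (G b)" "G 0 = 0"
  shows "G (lin_ext n T c) = lin_ext n (\<lambda>p. G (T p)) c"
proof -
  have "G (\<Sum>p\<in>A. smult (coeff c p) (T p)) = (\<Sum>p\<in>A. smult (coeff c p) (G (T p)))"
    if "finite A" for A :: "nat set"
    using that by (induction A rule: finite_induct) (simp_all add: assms)
  then show ?thesis by (simp add: lin_ext_def)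
qed

lemma poly_of_fps_eqI: "fps_of_poly q = f \<Longrightarrow> poly_of_fps f = q"
  unfolding poly_of_fps_def by (rule the_equality) (auto simp: fps_of_poly_eq_iff)


lemma binomial_series:
  "(1 - fps_X) ^ (k + 1) * Abs_fps (\<lambda>m. of_nat ((m + k) choose k)) = (1 :: complex fps)"
proof -
  have "inverse ((1 - fps_X) ^ (k + 1)) = Abs_fps (\<lambda>m. of_nat ((m + k) choose k) :: complex)"
    using one_minus_const_fps_X_neg_power' [of "k + 1" "1::complex"]
    by (simp add: fps_eq_iff add.commute del: power_Suc)
       (metis add_diff_cancel_left' binomial_symmetric le_add1)
  moreover have "((1 - fps_X) ^ (k + 1) :: complex fps) $ 0 \<noteq> 0"
    by (simp add: fps_nth_power_0 del: power_Suc)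
  ultimately show ?thesis by (metis inverse_mult_eq_1')
qed

lemma numerator_exists:
  "\<exists>q :: complex poly. degree q \<le> p \<and>
     fps_of_poly q = (1 - fps_X) ^ (k + 1 + p) *
       Abs_fps (\<lambda>m. of_nat m ^ p * of_nat ((m + k) choose k))"
proof (induction p)
  case 0
  show ?case using binomial_series [of k] by (intro exI [of _ 1]) simp
next
  case (Suc p)
  define f :: "complex fps" where "f = Abs_fps (\<lambda>m. of_nat m ^ p * of_nat ((m + k) choose k))"
  define d where "d = k + p"
  from Suc obtain q :: "complex poly" where q: "degree q \<le> p"
    "fps_of_poly q = (1 - fps_X) ^ Suc d * f"
    by (auto simp: f_def d_def)
  define r where "r = [:0, 1:] * [:1, - 1:] * pderiv q + smult (of_nat (Suc d)) ([:0, 1:] * q)"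
  have f': "Abs_fps (\<lambda>m. of_nat m ^ Suc p * of_nat ((m + k) choose k)) = fps_X * fps_deriv f"
    using fps_XD_nth [of f] by (auto simp: f_def fps_eq_iff fps_XD_def)
  have lin: "fps_of_poly [:1, - 1:] = (1 - fps_X :: complex fps)"
    by (simp add: fps_of_poly_pCons)
  have D: "fps_deriv (fps_of_poly q) =
      (1 - fps_X) ^ Suc d * fps_deriv f - of_nat (Suc d) * (1 - fps_X) ^ d * f"
    unfolding q(2) by (simp add: fps_deriv_power algebra_simps fps_of_nat del: power_Suc of_nat_Suc)
  have "fps_of_poly r = fps_X * (1 - fps_X) * fps_deriv (fps_of_poly q)
      + of_nat (Suc d) * (fps_X * fps_of_poly q)"
    by (simp add: r_def fps_of_poly_add fps_of_poly_mult fps_of_poly_smult fps_of_poly_pderiv lin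
        fps_of_nat del: of_nat_Suc mult_pCons_left mult_pCons_right)
  also have "\<dots> = (1 - fps_X) ^ Suc (Suc d) * (fps_X * fps_deriv f)"
    unfolding D unfolding q(2) by (simp only: power_Suc) algebra
  finally have "fps_of_poly r = (1 - fps_X) ^ (k + 1 + Suc p) *
       Abs_fps (\<lambda>m. of_nat m ^ Suc p * of_nat ((m + k) choose k))"
    unfolding f' by (simp add: d_def)
  moreover have "degree r \<le> Suc p"
  proof -
    have "degree ([:0, 1:] * [:1, - 1:] * pderiv q) \<le> Suc p"
    proof (cases "degree q = 0")
      case True
      then have "pderiv q = 0" by (simp add: pderiv_eq_0_iff)
      then show ?thesis by simp
    next
      case False
      have "degree ([:0, 1:] * [:1, - 1:] * pderiv q) \<le> degree ([:0, 1:] * [:1, - 1::complex:]) + degree (pderiv q)"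
        by (rule degree_mult_le)
      also have "degree ([:0, 1:] * [:1, - 1::complex:]) \<le> 2" by simp
      finally have "degree ([:0, 1:] * [:1, - 1:] * pderiv q) \<le> 2 + degree (pderiv q)" by simp
      then show ?thesis using False q(1) by (simp add: degree_pderiv del: mult_pCons_left mult_pCons_right)
    qed
    moreover have "degree (smult (of_nat (Suc d)) ([:0, 1:] * q)) \<le> Suc p"
      using degree_smult_le [of "of_nat (Suc d)" "[:0, 1:] * q"] degree_mult_le [of "[:0, 1:]" q] q(1)
      by (simp del: mult_pCons_left degree_smult_eq)
    ultimately show ?thesis unfolding r_def by (rule degree_add_le)
  qed
  ultimately show ?case by blast
qed

lemma numerator_exists':
  assumes "p \<le> n"
  shows "\<exists>q :: complex poly. degree q \<le> n \<and>
     fps_of_poly q = (1 - fps_X) ^ (k + n + 1) *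
       Abs_fps (\<lambda>m. of_nat m ^ p * of_nat ((m + k) choose k))"
proof -
  obtain q :: "complex poly" where q: "degree q \<le> p" "fps_of_poly q = (1 - fps_X) ^ (k + 1 + p) *
       Abs_fps (\<lambda>m. of_nat m ^ p * of_nat ((m + k) choose k))"
    using numerator_exists by blast
  have lin: "fps_of_poly [:1, - 1:] = (1 - fps_X :: complex fps)"
    by (simp add: fps_of_poly_pCons)
  have e: "k + n + 1 = (n - p) + (k + 1 + p)" using assms by simp
  have "degree ([:1, - 1:] ^ (n - p) * q) \<le> (n - p) + p"
    by (rule order_trans [OF degree_mult_le add_mono]) (use q(1) in \<open>simp_all add: degree_power_eq\<close>)
  moreover have "fps_of_poly ([:1, - 1:] ^ (n - p) * q) = (1 - fps_X) ^ (k + n + 1) *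
       Abs_fps (\<lambda>m. of_nat m ^ p * of_nat ((m + k) choose k))"
    unfolding e power_add [of _ "n - p"] by (simp only: fps_of_poly_mult fps_of_poly_power lin q(2) mult.assoc)
  ultimately show ?thesis using assms by auto
qed

lemma lin_ext_series:
  fixes g :: "complex fps" and h :: "nat \<Rightarrow> complex"
  assumes ex: "\<And>p. p \<le> n \<Longrightarrow>
      \<exists>q. degree q \<le> n \<and> fps_of_poly q = g * Abs_fps (\<lambda>m. of_nat m ^ p * h m)"
    and T: "\<And>p. p \<le> n \<Longrightarrow> T p = poly_of_fps (g * Abs_fps (\<lambda>m. of_nat m ^ p * h m))"
    and c: "degree c \<le> n"
  shows "degree (lin_ext n T c) \<le> n"
    and "fps_of_poly (lin_ext n T c) = g * Abs_fps (\<lambda>m. poly c (of_nat m) * h m)"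
proof -
  have T': "degree (T p) \<le> n \<and> fps_of_poly (T p) = g * Abs_fps (\<lambda>m. of_nat m ^ p * h m)"
    if "p \<le> n" for p
    using ex [OF that] T [OF that] poly_of_fps_eqI by fastforce
  then show "degree (lin_ext n T c) \<le> n" by (intro degree_lin_ext) auto
  have "fps_of_poly (lin_ext n T c)
      = (\<Sum>p\<le>n. fps_const (coeff c p) * (g * Abs_fps (\<lambda>m. of_nat m ^ p * h m)))"
    using T' by (simp add: lin_ext_def fps_of_poly_sum fps_of_poly_smult)
  also have "\<dots> = g * (\<Sum>p\<le>n. fps_const (coeff c p) * Abs_fps (\<lambda>m. of_nat m ^ p * h m))"
    by (simp add: sum_distrib_left mult.left_commute)
  also have "(\<Sum>p\<le>n. fps_const (coeff c p) * Abs_fps (\<lambda>m. of_nat m ^ p * h m))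
      = Abs_fps (\<lambda>m. poly c (of_nat m) * h m)"
  proof (rule fps_ext)
    fix m
    have "poly c (of_nat m) = (\<Sum>p\<le>n. coeff c p * of_nat m ^ p)"
      unfolding poly_altdef using c
      by (intro sum.mono_neutral_left) (auto simp: coeff_eq_0)
    then show "(\<Sum>p\<le>n. fps_const (coeff c p) * Abs_fps (\<lambda>m. of_nat m ^ p * h m)) $ m =
        Abs_fps (\<lambda>m. poly c (of_nat m) * h m) $ m"
      by (simp add: fps_sum_nth sum_distrib_right mult.assoc)
  qed
  finally show "fps_of_poly (lin_ext n T c) = g * Abs_fps (\<lambda>m. poly c (of_nat m) * h m)" .
qed

lemma
  assumes "degree c \<le> n"
  shows degree_opF: "degree (opF n c) \<le> n"
    and opF_series: "fps_of_poly (opF n c) =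
      (1 - fps_X) ^ (2 * n + 1) * Abs_fps (\<lambda>m. poly c (of_nat m) * of_nat ((m + n) choose n))"
  unfolding opF_def
  using numerator_exists' [of _ n n] assms
  by (auto intro!: lin_ext_series simp: mult_2 simp del: power_Suc)

lemma
  assumes "degree c \<le> n"
  shows degree_opU: "degree (opU n c) \<le> n"
    and opU_series: "fps_of_poly (opU n c) =
      fps_const (1 / fact n) * (1 - fps_X) ^ (n + 1) * Abs_fps (\<lambda>m. poly c (of_nat m))"
proof -
  have ex: "\<exists>q. degree q \<le> n \<and> fps_of_poly q =
      fps_const (1 / fact n) * (1 - fps_X) ^ (n + 1) * Abs_fps (\<lambda>m. of_nat m ^ p * (1 :: complex))"
    if p: "p \<le> n" for p
  proof -
    obtain q :: "complex poly" where "degree q \<le> n" "fps_of_poly q = (1 - fps_X) ^ (n + 1) *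
       Abs_fps (\<lambda>m. of_nat m ^ p)"
      using numerator_exists' [OF p, of 0] by auto
    then show ?thesis
      by (intro exI [of _ "smult (1 / fact n) q"]) (simp add: fps_of_poly_smult mult.assoc)
  qed
  show "degree (opU n c) \<le> n" "fps_of_poly (opU n c) =
      fps_const (1 / fact n) * (1 - fps_X) ^ (n + 1) * Abs_fps (\<lambda>m. poly c (of_nat m))"
    using lin_ext_series [OF ex _ assms, of "\<lambda>p. poly_of_fps
     (fps_const (1 / fact n) * (1 - fps_X) ^ (n + 1) * Abs_fps (\<lambda>m. of_nat m ^ p))"]
    by (simp_all add: opU_def)
qed

lemma degree_opU_inv: "degree (opU_inv n c) \<le> n"
proof -
  have f: "degree (falling [:0, 1::complex:] p) \<le> p" for p
  proof (induction p)
    case (Suc p)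
    have "degree ([:0, 1::complex:] - of_nat p) \<le> 1" by (simp add: of_nat_poly)
    then show ?case
      using Suc degree_mult_le [of "falling [:0, 1::complex:] p" "[:0, 1:] - of_nat p"]
      by (simp add: falling_def)
  qed (simp add: falling_def)
  have r: "degree (pochhammer [:1, 1::complex:] k) \<le> k" for k
  proof (induction k)
    case (Suc k)
    have "degree ([:1, 1::complex:] + of_nat k) \<le> 1" by (simp add: of_nat_poly)
    then show ?case
      using Suc degree_mult_le [of "pochhammer [:1, 1::complex:] k" "[:1, 1:] + of_nat k"]
      by (simp add: pochhammer_Suc)
  qed simp
  show ?thesis unfolding opU_inv_def
    by (rule degree_lin_ext, rule order_trans [OF degree_mult_le])
       (metis add_mono f r le_add_diff_inverse)
qed

lemma opU_opU_inv:
  assumes "degree c \<le> n"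
  shows "opU n (opU_inv n c) = c"
proof -
  define T where "T = (\<lambda>p. falling [:0, 1:] p * pochhammer [:1, 1::complex:] (n - p))"
  have "opU n (T p) = monom 1 p" if p: "p \<le> n" for p
  proof -
    have val: "poly (T p) (of_nat m) = (if m < p then 0 else fact n * of_nat ((m - p + n) choose n))" for m
    proof -
      have "poly (pochhammer q k) (of_nat m) = pochhammer (poly q (of_nat m)) k"
        for q :: "complex poly" and k
        by (simp add: pochhammer_prod poly_prod)
      then have e: "poly (T p) (of_nat m) =
          (\<Prod>i<p. of_nat m - of_nat i) * pochhammer (1 + of_nat m) (n - p)"
        by (simp add: T_def falling_def poly_prod)
      show ?thesis
      proof (cases "m < p")
        case True
        then have "(\<Prod>i<p. of_nat m - of_nat i :: complex) = 0"
          by (intro prod_zero) auto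
        then show ?thesis using True e by simp
      next
        case False
        have "(\<Prod>i<p. of_nat m - of_nat i) * fact (m - p) = (fact m :: complex)"
          using False
        proof (induction p)
          case (Suc p)
          then have "m - p = Suc (m - Suc p)" by simp
          then have "(of_nat m - of_nat p) * fact (m - Suc p) = (fact (m - p) :: complex)"
            using Suc.prems by (simp add: fact_Suc algebra_simps of_nat_diff)
          then show ?case using Suc by (simp add: mult.assoc)
        qed simp
        moreover have "fact m * pochhammer (1 + of_nat m) (n - p) = (fact (m + (n - p)) :: complex)"
          by (simp add: pochhammer_fact add.commute pochhammer_product'
              [of "1::complex" m "n - p"])
        moreover have "m + (n - p) = m - p + n" using False p by simp
        moreover have "fact n * of_nat ((m - p + n) choose n) * fact (m - p) = (fact (m - p + n) :: complex)"
          using binomial_fact_lemma [of n "m - p + n"]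
          by (metis (no_types, lifting) add_diff_cancel_right' le_add2 mult.assoc mult.commute
              of_nat_fact of_nat_mult)
        moreover have "poly (T p) (of_nat m) * fact (m - p) =
            ((\<Prod>i<p. of_nat m - of_nat i) * fact (m - p)) * pochhammer (1 + of_nat m) (n - p)"
          unfolding e by (simp only: ac_simps)
        ultimately have "poly (T p) (of_nat m) * fact (m - p) =
            fact n * of_nat ((m - p + n) choose n) * fact (m - p)"
          by simp
        then show ?thesis using False by simp
      qed
    qed
    have ser: "Abs_fps (\<lambda>m. poly (T p) (of_nat m)) =
        fps_const (fact n) * (fps_X ^ p * Abs_fps (\<lambda>m. of_nat ((m + n) choose n)))"
      by (rule fps_ext) (simp add: val fps_X_power_mult_nth)
    have deg: "degree (T p) \<le> n"
      using degree_opU_inv [of n "monom 1 p"] lin_ext_monom [OF p, of T 1]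
      by (simp add: opU_inv_def T_def)
    have "fps_of_poly (opU n (T p)) = fps_const (1 / fact n) * fps_const (fact n) *
        (fps_X ^ p * ((1 - fps_X) ^ (n + 1) * Abs_fps (\<lambda>m. of_nat ((m + n) choose n))))"
      unfolding opU_series [OF deg] ser by (simp only: ac_simps)
    also have "\<dots> = fps_X ^ p"
      unfolding binomial_series by simp
    finally show ?thesis
      by (metis fps_of_poly_monom' fps_of_poly_eq_iff)
  qed
  then have "lin_ext n (\<lambda>p. opU n (T p)) c = lin_ext n (monom 1) c"
    by (simp add: lin_ext_def)
  moreover have "opU n (lin_ext n T c) = lin_ext n (\<lambda>p. opU n (T p)) c"
    by (rule lin_ext_comp) (simp_all add: opU_def lin_ext_add lin_ext_smult, simp add: lin_ext_def)
  ultimately show ?thesis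
    using lin_ext_id [OF assms] by (simp add: opU_inv_def T_def)
qed

lemma opU_inv_opU:
  assumes "degree c \<le> n"
  shows "opU_inv n (opU n c) = c"
proof -
  let ?d = "opU_inv n (opU n c)"
  have "opU n ?d = opU n c"
    by (rule opU_opU_inv [OF degree_opU [OF assms]])
  then have "fps_const (1 / fact n) * (1 - fps_X) ^ (n + 1) * Abs_fps (\<lambda>m. poly ?d (of_nat m)) =
      fps_const (1 / fact n) * (1 - fps_X) ^ (n + 1) * Abs_fps (\<lambda>m. poly c (of_nat m) :: complex)"
    using opU_series [OF degree_opU_inv] opU_series [OF assms] by metis
  moreover have "(1 - fps_X :: complex fps) \<noteq> 0"
    by (metis fps_X_neq_one right_minus_eq)
  ultimately have "Abs_fps (\<lambda>m. poly ?d (of_nat m)) = Abs_fps (\<lambda>m. poly c (of_nat m))"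
    by simp
  then have eq: "poly (?d - c) (of_nat m) = 0" for m
    by (simp add: fps_eq_iff)
  have "infinite (range (of_nat :: nat \<Rightarrow> complex))"
    by (simp add: range_inj_infinite inj_of_nat)
  moreover have "range of_nat \<subseteq> {x. poly (?d - c) x = 0}"
    using eq by blast
  ultimately have "?d - c = 0"
    using poly_roots_finite finite_subset by blast
  then show ?thesis by simp
qed

lemma poly_lin_ext_homogenize:
  assumes c: "degree c \<le> n" and x: "poly l x \<noteq> 0"
  shows "poly (lin_ext n (\<lambda>p. monom 1 p * l ^ (n - p)) c) x = poly l x ^ n * poly c (x / poly l x)"
proof -
  have "poly c (x / poly l x) = (\<Sum>p\<le>n. coeff c p * (x / poly l x) ^ p)"
    unfolding poly_altdef using c
    by (intro sum.mono_neutral_left) (auto simp: coeff_eq_0)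
  moreover have "poly l x ^ n * (coeff c p * (x / poly l x) ^ p) =
      coeff c p * (x ^ p * poly l x ^ (n - p))" if "p \<le> n" for p
    using that x by (simp add: power_divide power_diff)
  ultimately have "poly l x ^ n * poly c (x / poly l x) =
      (\<Sum>p\<le>n. coeff c p * (x ^ p * poly l x ^ (n - p)))"
    by (simp only: sum_distrib_left) (rule sum.cong, simp_all only: atMost_iff)
  then show ?thesis
    by (simp add: lin_ext_def poly_sum poly_monom)
qed

lemma poly_opV:
  "degree c \<le> n \<Longrightarrow> 1 + x \<noteq> 0 \<Longrightarrow> poly (opV n c) x = (1 + x) ^ n * poly c (x / (1 + x))"
  using poly_lin_ext_homogenize [of c n "[:1, 1:]" x] by (simp add: opV_def)

lemma poly_opV_inv:
  "degree c \<le> n \<Longrightarrow> 1 - x \<noteq> 0 \<Longrightarrow> poly (opV_inv n c) x = (1 - x) ^ n * poly c (x / (1 - x))"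
  using poly_lin_ext_homogenize [of c n "[:1, - 1:]" x] by (simp add: opV_inv_def)

lemma degree_opC: "degree (opC n c) \<le> n"
  unfolding opC_def by (rule degree_lin_ext) (auto intro: order_trans [OF degree_monom_le])

lemma degree_lin_ext_homogenize:
  assumes "degree l \<le> 1"
  shows "degree (lin_ext n (\<lambda>p. monom 1 p * l ^ (n - p)) c) \<le> n"
proof (rule degree_lin_ext)
  fix p assume "p \<le> n"
  have "degree l * (n - p) \<le> n - p" using assms by (metis mult_le_mono1 mult_1)
  then have "degree (l ^ (n - p)) \<le> n - p" using degree_power_le le_trans by blast
  then have "degree (monom (1::complex) p) + degree (l ^ (n - p)) \<le> p + (n - p)"
    by (intro add_mono degree_monom_le)
  then show "degree (monom 1 p * l ^ (n - p)) \<le> n"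
    using degree_mult_le [of "monom (1::complex) p" "l ^ (n - p)"] \<open>p \<le> n\<close> by linarith
qed

lemma degree_opV: "degree (opV n c) \<le> n"
  unfolding opV_def by (rule degree_lin_ext_homogenize) simp

lemma degree_opV_inv: "degree (opV_inv n c) \<le> n"
  unfolding opV_inv_def by (rule degree_lin_ext_homogenize) simp

end

(* Both sides are the numerator over (1 - x)^(2n+1) of a power series whose m-th coefficient is
   n! binom(m+n, n) times a linear functional of c. On the monomial x^p the functional is
   binom(m+n-p, n) for the left side and the sum over k of binom(m, k) binom(n-p, n-k) for the
   right side, so the theorem is Vandermonde's identity. *)
theory Submission
  imports Defs
begin

text \<open>Since \<open>opU n\<close> undoes \<open>opU_inv n\<close>, the generating function of
  these values is \<open>fact n\<close> times \<open>c\<close> divided by (1 - x)^(n+1). The values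
  are therefore a convolution of the coefficients of \<open>c\<close> with the binomial
  series.\<close>

lemma poly_opU_inv_of_nat:
  assumes c: "degree c \<le> n"
  shows "poly (opU_inv n c) (of_nat m) =
    fact n * (\<Sum>p\<le>n. coeff c p * of_nat ((m + n - p) choose n))"
proof -
  define A :: "complex fps" where "A = Abs_fps (\<lambda>m. poly (opU_inv n c) (of_nat m))"
  define B :: "complex fps" where "B = Abs_fps (\<lambda>m. of_nat ((m + n) choose n))"
  have B: "(1 - fps_X) ^ (n + 1) * B = 1"
    unfolding B_def by (rule binomial_series)
  have "fps_of_poly c = fps_const (1 / fact n) * (1 - fps_X) ^ (n + 1) * A"
    using opU_series [OF degree_opU_inv [of n c]] opU_opU_inv [OF c] by (simp add: A_def)
  then have "fps_const (fact n) * (fps_of_poly c * B) =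
      (fps_const (fact n) * fps_const (1 / fact n)) * A * ((1 - fps_X) ^ (n + 1) * B)"
    by (simp only: ac_simps)
  then have "A = fps_const (fact n) * (fps_of_poly c * B)"
    unfolding B by simp
  then have "A $ m = fact n * (fps_of_poly c * B) $ m"
    by simp
  also have "(fps_of_poly c * B) $ m = (\<Sum>p=0..m. coeff c p * of_nat ((m - p + n) choose n))"
    by (simp add: fps_mult_nth B_def)
  also have "(\<Sum>p=0..m. coeff c p * of_nat ((m - p + n) choose n)) =
      (\<Sum>p\<in>{..n} \<inter> {..m}. coeff c p * of_nat ((m - p + n) choose n))"
    using c by (intro sum.mono_neutral_right) (auto simp: coeff_eq_0)
  \<comment> \<open>The added terms have m < p \<le> n, so m + n - p < n and their binomials
    vanish.\<close>
  also have "\<dots> = (\<Sum>p\<le>n. coeff c p * of_nat ((m + n - p) choose n))"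
    by (rule sum.mono_neutral_cong_left) auto
  finally show ?thesis by (simp add: A_def)
qed

text \<open>Dividing by (1 - x)^(2n+1) leaves x^k / (1 - x)^(n+k+1), a binomial series shifted by k.
  The coefficients below the shift agree because m + n < n + k for m < k.\<close>

lemma fps_X_power_one_minus_fps_X_power:
  assumes "k \<le> n"
  shows "fps_X ^ k * (1 - fps_X) ^ (n - k) =
    (1 - fps_X) ^ (2 * n + 1) * Abs_fps (\<lambda>m. of_nat ((m + n) choose (n + k)) :: complex)"
proof -
  have shift: "Abs_fps (\<lambda>m. of_nat ((m + n) choose (n + k)) :: complex) =
      fps_X ^ k * Abs_fps (\<lambda>m. of_nat ((m + (n + k)) choose (n + k)))"
    by (rule fps_ext) (auto simp: fps_X_power_mult_nth intro: arg_cong [of _ _ "\<lambda>i. i choose _"])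
  have "2 * n + 1 = (n - k) + (n + k + 1)"
    using assms by simp
  then have "(1 - fps_X) ^ (2 * n + 1) *
      Abs_fps (\<lambda>m. of_nat ((m + n) choose (n + k)) :: complex) =
      fps_X ^ k * (1 - fps_X) ^ (n - k) *
      ((1 - fps_X) ^ (n + k + 1) * Abs_fps (\<lambda>m. of_nat ((m + (n + k)) choose (n + k))))"
    unfolding shift by (simp only: power_add ac_simps)
  then show ?thesis
    unfolding binomial_series by simp
qed

text \<open>For k \<le> m both sides equal (m+n)! / (k! (m-k)!); otherwise both vanish. Thus the
  weight of \<open>opC\<close> splits off the factor binom(m+n, n) that occurs in
  \<open>opF\<close>.\<close>

lemma fact_quotient_times_choose:
  "fact (n + k) / fact k * of_nat ((m + n) choose (n + k)) =
    (fact n * of_nat ((m + n) choose n) * of_nat (m choose k) :: complex)"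
proof (cases "k \<le> m")
  case True
  then show ?thesis
    by (simp add: binomial_fact)
qed (simp add: binomial_eq_0)

text \<open>In effect, \<open>opV_inv n\<close> after \<open>opC n\<close> is \<open>opF n\<close>
  applied to \<open>fact n\<close> times the Newton expansion with coefficients
  \<open>coeff c k\<close> in the basis binom(x, k).\<close>

lemma opV_inv_opC_series:
  "fps_of_poly (opV_inv n (opC n c)) = (1 - fps_X) ^ (2 * n + 1) *
    Abs_fps (\<lambda>m. fact n * of_nat ((m + n) choose n) * (\<Sum>k\<le>n. coeff c k * of_nat (m choose k)))"
proof -
  define a :: "nat \<Rightarrow> complex" where "a k = coeff c k * (fact (n + k) / fact k)" for k
  have coeff_C: "coeff (opC n c) k = a k" if "k \<le> n" for k
    using that by (simp add: opC_def lin_ext_def coeff_sum a_def if_distrib cong: if_cong)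
  have lin: "fps_of_poly [:1, - 1:] = (1 - fps_X :: complex fps)"
    by (simp add: fps_of_poly_pCons)
  have "fps_of_poly (opV_inv n (opC n c)) =
      (\<Sum>k\<le>n. fps_const (a k) * (fps_X ^ k * (1 - fps_X) ^ (n - k)))"
    by (simp add: opV_inv_def lin_ext_def coeff_C fps_of_poly_sum fps_of_poly_smult
        fps_of_poly_mult fps_of_poly_power fps_of_poly_monom' lin)
  also have "\<dots> = (1 - fps_X) ^ (2 * n + 1) *
      (\<Sum>k\<le>n. fps_const (a k) * Abs_fps (\<lambda>m. of_nat ((m + n) choose (n + k))))"
    by (simp add: fps_X_power_one_minus_fps_X_power sum_distrib_left mult.left_commute
        del: power_Suc)
  also have "(\<Sum>k\<le>n. fps_const (a k) * Abs_fps (\<lambda>m. of_nat ((m + n) choose (n + k)))) =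
      Abs_fps (\<lambda>m. fact n * of_nat ((m + n) choose n) *
        (\<Sum>k\<le>n. coeff c k * of_nat (m choose k)))"
  proof (rule fps_ext)
    fix m
    have "a k * of_nat ((m + n) choose (n + k)) =
        fact n * of_nat ((m + n) choose n) * (coeff c k * of_nat (m choose k))" for k
      using arg_cong [OF fact_quotient_times_choose [of n k m], of "\<lambda>x. coeff c k * x"]
      by (simp only: a_def ac_simps)
    then show "(\<Sum>k\<le>n. fps_const (a k) * Abs_fps (\<lambda>m. of_nat ((m + n) choose (n + k)))) $ m =
        Abs_fps (\<lambda>m. fact n * of_nat ((m + n) choose n) *
          (\<Sum>k\<le>n. coeff c k * of_nat (m choose k))) $ m"
      by (simp add: fps_sum_nth sum_distrib_left)
  qed
  finally show ?thesis .
qed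

text \<open>The lower index is reflected from k - p to n - k. This covers k < p as well, where n - k
  > n - p makes the binomial zero, and gives the form that Vandermonde's identity needs.\<close>

lemma coeff_monom_mult_one_plus_power:
  assumes "p \<le> n" "k \<le> n"
  shows "coeff (monom 1 p * [:1, 1::complex:] ^ (n - p)) k = of_nat ((n - p) choose (n - k))"
proof (cases "k < p")
  case False
  then have "(n - p) choose (k - p) = (n - p) choose (n - k)"
    using binomial_symmetric [of "k - p" "n - p"] assms by simp
  then show ?thesis
    using False assms by (simp add: coeff_monom_mult coeff_linear_poly_power)
qed (use assms in \<open>simp add: coeff_monom_mult\<close>)

lemma sum_coeff_opV_choose:
  "(\<Sum>k\<le>n. coeff (opV n c) k * of_nat (m choose k)) =
    (\<Sum>p\<le>n. coeff c p * of_nat ((m + n - p) choose n))"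
proof -
  have "(\<Sum>k\<le>n. coeff (opV n c) k * of_nat (m choose k)) =
      (\<Sum>k\<le>n. \<Sum>p\<le>n. coeff c p * of_nat ((m choose k) * ((n - p) choose (n - k))))"
    by (simp add: opV_def lin_ext_def coeff_sum coeff_monom_mult_one_plus_power
        sum_distrib_left ac_simps)
  also have "\<dots> = (\<Sum>p\<le>n. coeff c p *
      of_nat (\<Sum>k\<le>n. (m choose k) * ((n - p) choose (n - k))))"
    by (subst sum.swap) (simp add: sum_distrib_left)
  \<comment> \<open>Vandermonde with upper indices m and n - p; their sum is m + n - p because p
    \<le> n.\<close>
  also have "\<dots> = (\<Sum>p\<le>n. coeff c p * of_nat ((m + n - p) choose n))"
    by (simp add: vandermonde)
  finally show ?thesis .
qed

theorem theorem4p1: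
  fixes n :: nat and c :: "complex poly"
  assumes "degree c \<le> n"
  shows "(opF n \<circ> opU_inv n) c = (opV_inv n \<circ> opC n \<circ> opV n) c"
proof -
  \<comment> \<open>Both series now carry the same functional of \<open>c\<close>, so only the order
    of factors differs; injectivity of \<open>fps_of_poly\<close> then gives equality of the
    polynomials.\<close>
  have "fps_of_poly (opF n (opU_inv n c)) = fps_of_poly (opV_inv n (opC n (opV n c)))"
    unfolding opF_series [OF degree_opU_inv] opV_inv_opC_series sum_coeff_opV_choose
      poly_opU_inv_of_nat [OF assms]
    by (simp only: ac_simps)
  then show ?thesis
    by (simp add: fps_of_poly_eq_iff)
qed

end
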